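(* Let $X$ be a locally compact metric space and $\pi_0$ a flow on $X$. Let $S\subset X$ be a (nonempty) attractor of $\pi_0$, and let $B\subset B'\subset X$ be nonempty compact stable isolating blocks for $\pi_0$ with $A_{\pi_0}(B)=A_{\pi_0}(B')=S$. Let $\pi$ be the flow on $\mathbb{R}\times X$ given by $(s,x)\pi t=(s+t,x\pi_0 t)$, and put $N:=\mathbb{R}\times B$. Let $(\pi_n)_{n\in\mathbb{N}}$ be a sequence of skew product flows on $\mathbb{R}\times X$ (i.e. the $\mathbb{R}$-component of $(s,x)\pi_n t$ is $s+t$) that converges semi-singularly to $\pi_0$. Then there exist $T_0>0$ and $n_0\in\mathbb{N}$ such that the following holds. Let $T\ge T_0$ and let $\delta>0$ be such that $$U_\delta(G_\pi^{2T}(N))\subset G_\pi^T(N),\qquad U_\delta(G_\pi^T(N))\subset N,\qquad U_\delta(B)\subset B',\qquad G_{\pi_0}^T(B')\subset B,\qquad U_\delta\bigl(G_\pi^T(U_\delta(N))\bigr)\subset N .$$ Then there is an $\epsilon>0$, depending only on $\pi_0$, $B$, $T$ (and the fixed $\delta$) and not on $n$, such that for every $n\ge n_0$ with $$d(x\pi_n t,x\pi t)<\frac{\delta}{3}\qquad\text{for all } t\in[-T,T]\text{ and all }x\in N,$$ the set $A_{\pi_n}(N)$ is nonempty, is an isolated invariant set for $\pi_n$, has compact $t$-slices (i.e. $A_{\pi_n}(N)\cap(\{t\}\times X)$ is compact for every $t\in\mathbb{R}$), and satisfies $$U_\epsilon(A_{\pi_n}(N))\subset G_{\pi_n}^T(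N).$$
   Context: Flows are written $x\pi t=\pi(t,x)$ and $x\pi[a,b]=\{x\pi t\mid t\in[a,b]\}$. $d$ denotes the metric (on $\mathbb{R}\times X$ a standard product metric, e.g. the maximum of $|s-s'|$ and the distance in $X$), and $U_\delta(Y)=\{x\mid d(x,Y)<\delta\}$. $P_1(s,x)=s$, $P_2(s,x)=x$. For a flow $\pi$ on a metric space $Z$ and $Y\subset Z$: a full left solution through $x$ is a map $\sigma$ defined on a set $J\subset\mathbb{R}$ with $\mathbb{R}^-=(-\infty,0]\subset J$, $\sigma(0)=x$ and $\sigma(t+s)=\sigma(t)\pi s$ whenever $t,t+s\in J$, $s>0$. Set $A_\pi^+(Y)=\{x\in Y\mid x\pi t\in Y\ \forall t\ge 0\}$, $A_\pi^-(Y)=\{x\in Y\mid \exists$ a full left solution $\sigma$ through $x$ with $\sigma(\mathbb{R}^-)\subset Y\}$ and $A_\pi(Y)=A_\pi^+(Y)\cap A_\pi^-(Y)$. $Y$ is positive invariant if $A_\pi^+(Y)=Y$. A closed set $Y$ is an isolating neighborhood if $A_\pi(Y)\subset\operatorname{int}Y$; it is a stable isolating neighborhood if in addition it is positive invariant. A set $K$ is an isolated invariant set if $K=A_\pi(Y)\subset\operatorname{int}Y$ for some closed $Y$. A stable isolating block is a stable isolating neighborhood $B$ such that for every $x\in\partial B$ there is $\eta>0$ with $x\pi(-t)\notin B$ and $x\pi t\in\operatorname{int}B$ for all $t\in(0,\eta)$. An attractor is an isolated invariant set of the form $S=A_{\pi_0}(B)=A_{\pi_0}^-(B)$ for a compact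 isolating neighborhood $B$ (stable isolating blocks for it then exist). For $T>0$ and a set $Y$: $G_\pi^T(Y)=\{x\mid x\pi[-T,T]\subset\operatorname{cl}Y\}$. Semi-singular convergence of $\pi_n$ (on $\mathbb{R}\times X$) to $\pi_0$ (on $X$): for all sequences $(s_n,x_n)\in\mathbb{R}\times X$ and $t_n\in\mathbb{R}^{\ge 0}$ with $x_n\to x_0$ and $t_n\to t_0$ (and $s_n$ arbitrary) one has $P_2((s_n,x_n)\pi_n t_n)\to x_0\pi_0t_0$. *)

theory Defs
  imports "HOL-Analysis.Analysis"
begin

text \<open>
  A flow is a continuous action of the additive group of the reals; \<open>\<pi> x t\<close> stands for \<open>x\<pi>t\<close>.
\<close>
definition flow :: "('z::metric_space \<Rightarrow> real \<Rightarrow> 'z) \<Rightarrow> bool" where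
  "flow \<pi> \<longleftrightarrow>
     continuous_on UNIV (\<lambda>(x, t). \<pi> x t) \<and>
     (\<forall>x. \<pi> x 0 = x) \<and>
     (\<forall>x s t. \<pi> (\<pi> x s) t = \<pi> x (s + t))"

text \<open>
  The partial map \<open>\<sigma> : J \<rightarrow> Z\<close> is a total function of which only the values on \<open>J\<close> matter.
\<close>
definition full_left_solution ::
    "('z \<Rightarrow> real \<Rightarrow> 'z) \<Rightarrow> 'z \<Rightarrow> real set \<Rightarrow> (real \<Rightarrow> 'z) \<Rightarrow> bool" where
  "full_left_solution \<pi> x J \<sigma> \<longleftrightarrow>
     {..0} \<subseteq> J \<and> \<sigma> 0 = x \<and>
     (\<forall>t s. t \<in> J \<longrightarrow> t + s \<in> J \<longrightarrow> 0 < s \<longrightarrow> \<sigma> (t + s) = \<pi> (\<sigma> t) s)"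

definition A_plus :: "('z \<Rightarrow> real \<Rightarrow> 'z) \<Rightarrow> 'z set \<Rightarrow> 'z set" where
  "A_plus \<pi> Y = {x \<in> Y. \<forall>t\<ge>0. \<pi> x t \<in> Y}"

definition A_minus :: "('z \<Rightarrow> real \<Rightarrow> 'z) \<Rightarrow> 'z set \<Rightarrow> 'z set" where
  "A_minus \<pi> Y = {x \<in> Y. \<exists>J \<sigma>. full_left_solution \<pi> x J \<sigma> \<and> \<sigma> ` {..0} \<subseteq> Y}"

definition A_inv :: "('z \<Rightarrow> real \<Rightarrow> 'z) \<Rightarrow> 'z set \<Rightarrow> 'z set" where
  "A_inv \<pi> Y = A_plus \<pi> Y \<inter> A_minus \<pi> Y"

definition positive_invariant :: "('z \<Rightarrow> real \<Rightarrow> 'z) \<Rightarrow> 'z set \<Rightarrow> bool" where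
  "positive_invariant \<pi> Y \<longleftrightarrow> A_plus \<pi> Y = Y"

definition isolating_neighborhood ::
    "('z::metric_space \<Rightarrow> real \<Rightarrow> 'z) \<Rightarrow> 'z set \<Rightarrow> bool" where
  "isolating_neighborhood \<pi> Y \<longleftrightarrow> closed Y \<and> A_inv \<pi> Y \<subseteq> interior Y"

definition stable_isolating_neighborhood ::
    "('z::metric_space \<Rightarrow> real \<Rightarrow> 'z) \<Rightarrow> 'z set \<Rightarrow> bool" where
  "stable_isolating_neighborhood \<pi> Y \<longleftrightarrow>
     isolating_neighborhood \<pi> Y \<and> positive_invariant \<pi> Y"

definition isolated_invariant_set ::
    "('z::metric_space \<Rightarrow> real \<Rightarrow> 'z) \<Rightarrow> 'z set \<Rightarrow> bool" where
  "isolated_invariant_set \<pi> K \<longleftrightarrow> (\<exists>Y. closed Y \<and> K = A_inv \<pi> Y \<and> K \<subseteq> interior Y)"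

definition stable_isolating_block ::
    "('z::metric_space \<Rightarrow> real \<Rightarrow> 'z) \<Rightarrow> 'z set \<Rightarrow> bool" where
  "stable_isolating_block \<pi> B \<longleftrightarrow>
     stable_isolating_neighborhood \<pi> B \<and>
     (\<forall>x\<in>frontier B. \<exists>\<eta>>0. \<forall>t\<in>{0<..<\<eta>}. \<pi> x (- t) \<notin> B \<and> \<pi> x t \<in> interior B)"

definition attractor :: "('z::metric_space \<Rightarrow> real \<Rightarrow> 'z) \<Rightarrow> 'z set \<Rightarrow> bool" where
  "attractor \<pi> S \<longleftrightarrow>
     isolated_invariant_set \<pi> S \<and>
     (\<exists>B. compact B \<and> isolating_neighborhood \<pi> B \<and> S = A_inv \<pi> B \<and> S = A_minus \<pi> B)"

definition G_set ::
    "('z::metric_space \<Rightarrow> real \<Rightarrow> 'z) \<Rightarrow> real \<Rightarrow> 'z set \<Rightarrow> 'z set" where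
  "G_set \<pi> T Y = {x. \<pi> x ` {-T..T} \<subseteq> closure Y}"

text \<open>
  The conjunct \<open>Y \<noteq> {}\<close> implements \<open>d(x, {}) = \<infinity>\<close>; the library sets \<^term>\<open>infdist x {} = 0\<close>.
\<close>
definition U_nbhd :: "real \<Rightarrow> 'z::metric_space set \<Rightarrow> 'z set" where
  "U_nbhd \<delta> Y = {x. Y \<noteq> {} \<and> infdist x Y < \<delta>}"

definition skew_product_flow ::
    "(real \<times> 'a::metric_space \<Rightarrow> real \<Rightarrow> real \<times> 'a) \<Rightarrow> bool" where
  "skew_product_flow \<pi> \<longleftrightarrow> flow \<pi> \<and> (\<forall>s x t. fst (\<pi> (s, x) t) = s + t)"

definition semi_singular_convergence ::
    "(nat \<Rightarrow> real \<times> 'a::metric_space \<Rightarrow> real \<Rightarrow> real \<times> 'a) \<Rightarrow> ('a \<Rightarrow> real \<Rightarrow> 'a) \<Rightarrow> bool" where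
  "semi_singular_convergence \<pi>n \<pi>0 \<longleftrightarrow>
     (\<forall>(s :: nat \<Rightarrow> real) x t x0 t0.
        x \<longlonglongrightarrow> x0 \<longrightarrow> (\<forall>n. 0 \<le> t n) \<longrightarrow> t \<longlonglongrightarrow> t0 \<longrightarrow>
        (\<lambda>n. snd (\<pi>n n (s n, x n) (t n))) \<longlonglongrightarrow> \<pi>0 x0 t0)"

end

theory Submission
  imports Defs
begin

text \<open>
  Since \<open>\<pi>n n\<close> is a flow, \<open>A_inv (\<pi>n n) N\<close> consists of the points whose entire orbit stays
  in \<open>N = \<real> \<times> B\<close>. This set \<open>K\<close> is closed, and its time slices are compact because \<open>B\<close> is.

  Isolation. Let \<open>z \<in> K\<close>. The \<open>\<pi>n n\<close>-orbit of \<open>z\<close> lies in \<open>N\<close>, so the \<open>\<pi>\<close>-orbit of \<open>z\<close> over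
  \<open>[-T, T]\<close> is \<open>\<delta>/3\<close>-close to \<open>N\<close>, that is, \<open>z\<close> lies in \<open>G_set \<pi> T (U_nbhd \<delta> N)\<close>. The last
  inclusion of the hypothesis then puts the whole \<open>\<delta>\<close>-ball around \<open>z\<close> into \<open>N\<close>
  (lemma \<open>ball_about_full_orbit\<close>).

  The neighbourhood of uniform size. The flow \<open>\<pi>0\<close> is uniformly continuous on
  \<open>B \<times> [-T, T]\<close>, so some \<open>\<epsilon> \<le> \<delta>\<close>, chosen from \<open>\<pi>0\<close>, \<open>B\<close>, \<open>T\<close> and \<open>\<delta>\<close> alone, makes
  \<open>\<epsilon>\<close>-close points of \<open>N\<close> stay \<open>\<delta>/3\<close>-close under \<open>\<pi>\<close> (lemma \<open>product_flow_equicontinuous\<close>).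
  If \<open>y\<close> is \<open>\<epsilon>\<close>-close to \<open>z \<in> K\<close>, then \<open>y \<in> N\<close>, and
  comparing \<open>\<pi>n n\<close> with \<open>\<pi>\<close> at \<open>y\<close> and at \<open>z\<close> shows that the two \<open>\<pi>n n\<close>-orbits are
  \<open>\<delta>\<close>-close on \<open>[-T, T]\<close>. As the orbit of \<open>z\<close> runs in \<open>K\<close>, the orbit of \<open>y\<close> is in \<open>N\<close>.

  Nonemptiness. The flow \<open>\<pi>0\<close> moves the block \<open>B\<close> into its interior at every positive time. By
  compactness and semi-singular convergence, for large \<open>n\<close> the flow \<open>\<pi>n n\<close> maps \<open>N\<close> into \<open>N\<close> at
  all times in \<open>[1, 2]\<close> (lemma \<open>eventually_absorbing\<close>), hence at all times \<open>t \<ge> 1\<close>. Points started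
  in \<open>N\<close> at time \<open>-m\<close> arrive at time \<open>0\<close> in the compact set \<open>{0} \<times> B\<close>, and any accumulation
  point of these arrivals, as \<open>m\<close> tends to infinity, has its full orbit in \<open>N\<close>.
\<close>

section \<open>Invariant sets and blocks of flows\<close>

lemma flow_zero: "flow \<pi> \<Longrightarrow> \<pi> x 0 = x"
  by (simp add: flow_def)

lemma flow_add: "flow \<pi> \<Longrightarrow> \<pi> (\<pi> x s) t = \<pi> x (s + t)"
  by (simp add: flow_def)

lemma continuous_flow:
  assumes "flow \<pi>"
  shows "continuous_on UNIV (\<lambda>x. \<pi> x t)"
proof -
  have "continuous_on UNIV ((\<lambda>(x, t). \<pi> x t) \<circ> (\<lambda>x. (x, t)))"
    using assms unfolding flow_def
    by (intro continuous_on_compose continuous_intros) (auto elim: continuous_on_subset)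
  then show ?thesis by (simp add: o_def)
qed

text \<open>
  Backward orbits of a flow are unique, so the only full left solution through \<open>x\<close> is
  \<open>t \<mapsto> \<pi> x t\<close>.
\<close>
lemma A_inv_flow:
  assumes "flow \<pi>"
  shows "A_inv \<pi> Y = {x. \<forall>t. \<pi> x t \<in> Y}"
proof (intro set_eqI iffI)
  fix x assume x: "x \<in> A_inv \<pi> Y"
  then obtain J \<sigma> where fls: "full_left_solution \<pi> x J \<sigma>" and \<sigma>: "\<sigma> ` {..0} \<subseteq> Y"
    by (auto simp: A_inv_def A_minus_def)
  have "\<pi> x t \<in> Y" for t
  proof (cases "0 \<le> t")
    case True
    then show ?thesis using x by (auto simp: A_inv_def A_plus_def)
  next
    case False
    then have "\<sigma> (t + (- t)) = \<pi> (\<sigma> t) (- t)"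
      using fls unfolding full_left_solution_def
      by (metis add.right_inverse atMost_iff less_eq_real_def neg_0_less_iff_less not_less subsetD)
    then have "x = \<pi> (\<sigma> t) (- t)"
      using fls by (simp add: full_left_solution_def)
    then have "\<pi> x t = \<sigma> t"
      using assms by (simp add: flow_add flow_zero)
    then show ?thesis using \<sigma> False by auto
  qed
  then show "x \<in> {x. \<forall>t. \<pi> x t \<in> Y}" by blast
next
  fix x assume "x \<in> {x. \<forall>t. \<pi> x t \<in> Y}"
  then have x: "\<pi> x t \<in> Y" for t by blast
  have "full_left_solution \<pi> x UNIV (\<pi> x)"
    using assms by (simp add: full_left_solution_def flow_add flow_zero)
  moreover have "x \<in> Y" using x[of 0] assms by (simp add: flow_zero)
  ultimately show "x \<in> A_inv \<pi> Y"
    unfolding A_inv_def A_plus_def A_minus_def using x by blast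
qed

lemma A_inv_flow_invariant:
  assumes "flow \<pi>" and "z \<in> A_inv \<pi> Y"
  shows "\<pi> z t \<in> A_inv \<pi> Y"
  using assms by (simp add: A_inv_flow flow_add)

lemma closed_A_inv:
  assumes "flow \<pi>" and "closed Y"
  shows "closed (A_inv \<pi> Y)"
proof -
  have "A_inv \<pi> Y = (\<Inter>t. (\<lambda>x. \<pi> x t) -` Y)"
    using assms(1) by (auto simp: A_inv_flow)
  then show ?thesis
    using assms continuous_flow by (auto intro!: closed_INT closed_vimage)
qed

text \<open>
  Boundary points of the block enter the interior at once, and for \<open>t \<ge> 0\<close> the time-\<open>t\<close> map is a homeomorphism,
  so it carries the interior of a positive invariant set onto an open subset of that set.
\<close>
lemma stable_isolating_block_enters_interior:
  assumes fl: "flow \<pi>" and bl: "stable_isolating_block \<pi> B" and x: "x \<in> B" and t: "0 < t"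
  shows "\<pi> x t \<in> interior B"
proof -
  have pos: "\<pi> y s \<in> B" if "y \<in> B" "0 \<le> s" for y s
  proof -
    have "y \<in> A_plus \<pi> B"
      using bl that by (simp add: stable_isolating_block_def stable_isolating_neighborhood_def
          positive_invariant_def)
    then show ?thesis using that by (simp add: A_plus_def)
  qed
  have cl: "closed B"
    using bl by (simp add: stable_isolating_block_def stable_isolating_neighborhood_def
        isolating_neighborhood_def)
  have int: "\<pi> y s \<in> interior B" if y: "y \<in> interior B" and s: "0 \<le> s" for y s
  proof (rule interiorI)
    let ?V = "(\<lambda>z. \<pi> z (- s)) -` interior B"
    show "open ?V" by (intro open_vimage continuous_flow fl) auto
    show "\<pi> y s \<in> ?V" using y fl by (simp add: flow_add flow_zero)
    show "?V \<subseteq> B"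
    proof
      fix z assume "z \<in> ?V"
      then have "\<pi> (\<pi> z (- s)) s \<in> B" using pos s interior_subset by blast
      then show "z \<in> B" using fl by (simp add: flow_add flow_zero)
    qed
  qed
  show ?thesis
  proof (cases "x \<in> interior B")
    case True
    then show ?thesis using int t by simp
  next
    case False
    then have "x \<in> frontier B" using x cl by (simp add: frontier_def)
    then obtain \<eta> where \<eta>: "0 < \<eta>" "\<And>r. r \<in> {0<..<\<eta>} \<Longrightarrow> \<pi> x r \<in> interior B"
      using bl unfolding stable_isolating_block_def by blast
    define r where "r = min t (\<eta> / 2)"
    have r: "r \<in> {0<..<\<eta>}" "r \<le> t" using \<eta> t by (auto simp: r_def)
    then have "\<pi> (\<pi> x r) (t - r) \<in> interior B" by (intro int \<eta>) auto
    then show ?thesis using fl by (simp add: flow_add)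
  qed
qed

section \<open>Existence of full orbits\<close>

text \<open>
  This turns a statement about full sequences, such as semi-singular convergence, into one about
  subsequences.
\<close>
lemma LIMSEQ_fill_subsequence:
  fixes g :: "nat \<Rightarrow> 'b::metric_space"
  assumes r: "strict_mono r" and lim: "(g \<circ> r) \<longlonglongrightarrow> l"
  shows "(\<lambda>n. if n \<in> range r then g n else l) \<longlonglongrightarrow> l"
proof (rule metric_LIMSEQ_I)
  fix e :: real assume e: "0 < e"
  then obtain k0 where k0: "\<And>k. k \<ge> k0 \<Longrightarrow> dist (g (r k)) l < e"
    using metric_LIMSEQ_D[OF lim] by fastforce
  have "dist (if n \<in> range r then g n else l) l < e" if "n \<ge> r k0" for n
    using that k0 e r by (auto simp: strict_mono_less_eq)
  then show "\<exists>m. \<forall>n\<ge>m. dist (if n \<in> range r then g n else l) l < e" by blast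
qed

text \<open>
  Points of \<open>C\<close> and times in \<open>[a, b]\<close> that violate the inclusion for infinitely many \<open>n\<close> would
  accumulate at a point whose image lies in the open set \<open>U\<close>, against semi-singular convergence.
\<close>
lemma eventually_absorbing:
  fixes \<pi>n :: "nat \<Rightarrow> real \<times> 'a::metric_space \<Rightarrow> real \<Rightarrow> real \<times> 'a"
  assumes conv: "semi_singular_convergence \<pi>n \<pi>0"
    and C: "compact C" and U: "open U" and a: "0 \<le> a"
    and into: "\<And>x t. x \<in> C \<Longrightarrow> t \<in> {a..b} \<Longrightarrow> \<pi>0 x t \<in> U"
  shows "\<exists>n0. \<forall>n\<ge>n0. \<forall>s. \<forall>x\<in>C. \<forall>t\<in>{a..b}. snd (\<pi>n n (s, x) t) \<in> U"
proof (rule ccontr)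
  define bad where
    "bad n \<longleftrightarrow> (\<exists>s x t. x \<in> C \<and> t \<in> {a..b} \<and> snd (\<pi>n n (s, x) t) \<notin> U)" for n
  assume "\<not> ?thesis"
  then have "\<forall>m. \<exists>n\<ge>m. bad n" unfolding bad_def by meson
  then have inf: "infinite {n. bad n}" by (simp add: infinite_nat_iff_unbounded_le)
  define e where "e = enumerate {n. bad n}"
  have e: "strict_mono e" "bad (e k)" for k
    using inf enumerate_in_set[OF inf] by (auto simp: e_def strict_mono_enumerate)
  have "\<forall>n. \<exists>s x t. bad n \<longrightarrow> x \<in> C \<and> t \<in> {a..b} \<and> snd (\<pi>n n (s, x) t) \<notin> U"
    by (auto simp: bad_def)
  then obtain s x t where sxt: "\<And>n. bad n \<Longrightarrow> x n \<in> C \<and> t n \<in> {a..b} \<and> snd (\<pi>n n (s n, x n) (t n)) \<notin> U"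
    unfolding choice_iff by blast
  have "seq_compact (C \<times> {a..b})"
    using C by (intro compact_imp_seq_compact compact_Times) auto
  moreover have "\<forall>k. (x (e k), t (e k)) \<in> C \<times> {a..b}" using sxt e by blast
  ultimately obtain l q where l: "l \<in> C \<times> {a..b}" and q: "strict_mono q"
    and lim: "((\<lambda>k. (x (e k), t (e k))) \<circ> q) \<longlonglongrightarrow> l"
    by (rule seq_compactE)
  define r where "r = e \<circ> q"
  have r: "strict_mono r" using e q by (simp add: r_def strict_mono_o)
  have limx: "(x \<circ> r) \<longlonglongrightarrow> fst l"
    using tendsto_fst[OF lim] by (simp add: r_def o_def)
  have limt: "(t \<circ> r) \<longlonglongrightarrow> snd l"
    using tendsto_snd[OF lim] by (simp add: r_def o_def)
  define X where "X n = (if n \<in> range r then x n else fst l)" for n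
  define \<tau> where "\<tau> n = (if n \<in> range r then t n else snd l)" for n
  have X: "X \<longlonglongrightarrow> fst l" unfolding X_def by (rule LIMSEQ_fill_subsequence[OF r limx])
  have \<tau>: "\<tau> \<longlonglongrightarrow> snd l" unfolding \<tau>_def by (rule LIMSEQ_fill_subsequence[OF r limt])
  have "\<forall>n. 0 \<le> \<tau> n"
  proof
    fix n
    have "0 \<le> t n" if "n \<in> range r"
    proof -
      have "bad n" using that e(2) by (auto simp: r_def)
      then show ?thesis using sxt[of n] a by auto
    qed
    then show "0 \<le> \<tau> n" using l a by (auto simp: \<tau>_def)
  qed
  then have "(\<lambda>n. snd (\<pi>n n (s n, X n) (\<tau> n))) \<longlonglongrightarrow> \<pi>0 (fst l) (snd l)"
    using conv X \<tau> unfolding semi_singular_convergence_def by blast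
  moreover have "\<pi>0 (fst l) (snd l) \<in> U" using into l by auto
  ultimately have "eventually (\<lambda>n. snd (\<pi>n n (s n, X n) (\<tau> n)) \<in> U) sequentially"
    using U topological_tendstoD by blast
  then obtain m where "\<And>n. n \<ge> m \<Longrightarrow> snd (\<pi>n n (s n, X n) (\<tau> n)) \<in> U"
    by (auto simp: eventually_sequentially)
  then have "snd (\<pi>n (r m) (s (r m), x (r m)) (t (r m))) \<in> U"
    using seq_suble[OF r, of m] by (metis X_def \<tau>_def rangeI)
  then show False using sxt[of "r m"] e(2) by (simp add: r_def)
qed

lemma absorbing_all_later_times:
  assumes fl: "flow \<pi>" and a: "0 < a"
    and absorb: "\<And>z t. z \<in> N \<Longrightarrow> t \<in> {a..2 * a} \<Longrightarrow> \<pi> z t \<in> N"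
    and z: "z \<in> N" and t: "a \<le> t"
  shows "\<pi> z t \<in> N"
proof -
  have "\<pi> z t \<in> N" if "z \<in> N" "a \<le> t" "t \<le> (real k + 2) * a" for k z t
    using that
  proof (induction k arbitrary: z t)
    case 0
    then show ?case using absorb by simp
  next
    case (Suc k)
    show ?case
    proof (cases "t \<le> 2 * a")
      case True
      then show ?thesis using Suc.prems absorb by simp
    next
      case False
      have "\<pi> (\<pi> z a) (t - a) \<in> N"
        using Suc.prems False a absorb by (intro Suc.IH) (auto simp: algebra_simps)
      then show ?thesis using fl by (simp add: flow_add)
    qed
  qed
  moreover obtain k :: nat where "t < real k * a" using ex_less_of_nat_mult[OF a] by blast
  then have "t \<le> (real k + 2) * a" using a by (simp add: algebra_simps)
  ultimately show ?thesis using z t by blast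
qed

text \<open>
  Pullback construction: the arrivals at time \<open>0\<close> of points started in \<open>\<real> \<times> B\<close> at time \<open>-m\<close>
  accumulate, and a limit inherits the history of arbitrary length.
\<close>
lemma skew_product_full_orbit_exists:
  fixes \<pi> :: "real \<times> 'a::metric_space \<Rightarrow> real \<Rightarrow> real \<times> 'a"
  assumes skew: "skew_product_flow \<pi>" and B: "compact B" "B \<noteq> {}"
    and absorb: "\<And>z t. z \<in> UNIV \<times> B \<Longrightarrow> a \<le> t \<Longrightarrow> \<pi> z t \<in> UNIV \<times> B"
  shows "A_inv \<pi> (UNIV \<times> B) \<noteq> {}"
proof -
  have fl: "flow \<pi>" using skew by (simp add: skew_product_flow_def)
  obtain b where b: "b \<in> B" using B by blast
  obtain i :: nat where i: "a \<le> real i" using real_arch_simple by blast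
  \<comment> \<open>Start times \<open>-(m + i)\<close> with \<open>i \<ge> a\<close> leave enough time for every arrival to be in \<open>\<real> \<times> B\<close>.\<close>
  define z where "z m = \<pi> (- real (m + i), b) (real (m + i))" for m
  have "z m \<in> {0} \<times> B" for m
  proof -
    have "fst (z m) = 0" using skew by (simp add: z_def skew_product_flow_def)
    moreover have "z m \<in> UNIV \<times> B" unfolding z_def using b i by (intro absorb) auto
    ultimately show ?thesis by (cases "z m") auto
  qed
  then have "\<forall>m. z m \<in> {0} \<times> B" ..
  moreover have "seq_compact ({0 :: real} \<times> B)"
    using B by (intro compact_imp_seq_compact compact_Times) auto
  ultimately obtain l q where q: "strict_mono q" and lim: "(z \<circ> q) \<longlonglongrightarrow> l"
    by (blast elim: seq_compactE)
  have "\<pi> l t \<in> UNIV \<times> B" for t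
  proof (rule Lim_in_closed_set)
    show "closed ((UNIV :: real set) \<times> B)"
      using B by (intro closed_Times) (auto intro: compact_imp_closed)
    show "((\<lambda>k. \<pi> (z (q k)) t) \<longlongrightarrow> \<pi> l t) sequentially"
      using continuous_on_tendsto_compose[OF continuous_flow[OF fl] lim] by (simp add: o_def)
    obtain m :: nat where m: "a - t \<le> real m" using real_arch_simple by blast
    have "\<pi> (z (q k)) t \<in> UNIV \<times> B" if "k \<ge> m" for k
    proof -
      have "m \<le> q k" using seq_suble[OF q, of k] that by simp
      then have "a \<le> real (q k + i) + t" using m by linarith
      then have "\<pi> (- real (q k + i), b) (real (q k + i) + t) \<in> UNIV \<times> B"
        using b by (intro absorb) auto
      then show ?thesis using fl by (simp add: z_def flow_add)
    qed
    then show "\<forall>\<^sub>F k in sequentially. \<pi> (z (q k)) t \<in> UNIV \<times> B"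
      by (auto simp: eventually_sequentially)
  qed auto
  then have "l \<in> A_inv \<pi> (UNIV \<times> B)" using fl by (simp add: A_inv_flow)
  then show ?thesis by blast
qed

section \<open>Comparison of nearby flows\<close>

lemma U_nbhd_iff: "x \<in> U_nbhd \<delta> Y \<longleftrightarrow> (\<exists>y\<in>Y. dist x y < \<delta>)"
proof (cases "Y = {}")
  case False
  then show ?thesis
    unfolding U_nbhd_def infdist_notempty[OF False]
    by (auto simp: cINF_less_iff)
qed (simp add: U_nbhd_def)

lemma product_flow_equicontinuous:
  fixes \<pi>0 :: "'a::metric_space \<Rightarrow> real \<Rightarrow> 'a"
  assumes fl: "flow \<pi>0" and B: "compact B" and \<delta>: "0 < \<delta>"
  shows "\<exists>\<epsilon>>0. \<epsilon> \<le> \<delta> \<and> (\<forall>s s'. \<forall>x\<in>B. \<forall>y\<in>B. \<forall>t\<in>{-T..T}. dist (s, x) (s', y) < \<epsilon> \<longrightarrow>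
           dist (s + t, \<pi>0 x t) (s' + t, \<pi>0 y t) < \<delta>)"
proof -
  have "uniformly_continuous_on (B \<times> {-T..T}) (\<lambda>(x, t). \<pi>0 x t)"
    using fl B unfolding flow_def
    by (intro compact_uniformly_continuous compact_Times) (auto elim: continuous_on_subset)
  then obtain e where e: "0 < e"
    "\<And>p p'. p \<in> B \<times> {-T..T} \<Longrightarrow> p' \<in> B \<times> {-T..T} \<Longrightarrow> dist p' p < e \<Longrightarrow>
      dist ((\<lambda>(x, t). \<pi>0 x t) p') ((\<lambda>(x, t). \<pi>0 x t) p) < \<delta> / 2"
    using \<delta> unfolding uniformly_continuous_on_def by (metis half_gt_zero)
  have "dist (s + t, \<pi>0 x t) (s' + t, \<pi>0 y t) < \<delta>"
    if "x \<in> B" "y \<in> B" "t \<in> {-T..T}" "dist (s, x) (s', y) < min e (\<delta> / 2)" for s s' x y t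
  proof -
    have "dist x y < e" "dist s s' < \<delta> / 2"
      using that(4) dist_fst_le[of "(s, x)" "(s', y)"] dist_snd_le[of "(s, x)" "(s', y)"]
      by auto
    moreover have "dist (x, t) (y, t) = dist x y" by (simp add: dist_Pair_Pair)
    ultimately have "dist (\<pi>0 x t) (\<pi>0 y t) < \<delta> / 2" "dist (s + t) (s' + t) < \<delta> / 2"
      using e(2)[of "(y, t)" "(x, t)"] that by (auto simp: dist_real_def)
    moreover have "dist (s + t, \<pi>0 x t) (s' + t, \<pi>0 y t)
        \<le> dist (s + t) (s' + t) + dist (\<pi>0 x t) (\<pi>0 y t)"
      unfolding dist_Pair_Pair by (intro sqrt_sum_squares_le_sum) auto
    ultimately show ?thesis by linarith
  qed
  then show ?thesis using e(1) \<delta> by (intro exI[of _ "min e (\<delta> / 2)"]) auto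
qed

text \<open>
  A full \<open>\<phi>\<close>-orbit in \<open>N\<close> is shadowed over \<open>[-T, T]\<close> by the \<open>\<pi>\<close>-orbit of the same point, which
  is why that point satisfies the \<open>\<pi>\<close>-condition \<open>G_set \<pi> T (U_nbhd \<delta> N)\<close>.
\<close>
lemma ball_about_full_orbit:
  assumes fl: "flow \<phi>"
    and near: "\<And>t z. t \<in> {-T..T} \<Longrightarrow> z \<in> N \<Longrightarrow> dist (\<phi> z t) (\<pi> z t) < \<delta>"
    and incl: "U_nbhd \<delta> (G_set \<pi> T (U_nbhd \<delta> N)) \<subseteq> N"
    and z: "z \<in> A_inv \<phi> N" and y: "dist y z < \<delta>"
  shows "y \<in> N"
proof -
  have orbit: "\<phi> z t \<in> N" for t using z fl by (simp add: A_inv_flow)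
  have "z \<in> N" using orbit[of 0] fl by (simp add: flow_zero)
  then have "\<pi> z t \<in> U_nbhd \<delta> N" if "t \<in> {-T..T}" for t
    using near[OF that] orbit[of t] by (auto simp: U_nbhd_iff dist_commute)
  then have "z \<in> G_set \<pi> T (U_nbhd \<delta> N)"
    using closure_subset by (fastforce simp: G_set_def)
  then have "y \<in> U_nbhd \<delta> (G_set \<pi> T (U_nbhd \<delta> N))"
    unfolding U_nbhd_iff[of y] using y by blast
  then show ?thesis using incl by blast
qed

section \<open>Persistence of the attractor\<close>

theorem theorem9:
  fixes \<pi>0 :: "'a::metric_space \<Rightarrow> real \<Rightarrow> 'a"
    and \<pi> :: "real \<times> 'a \<Rightarrow> real \<Rightarrow> real \<times> 'a"
    and S B :: "'a set"
    and N :: "(real \<times> 'a) set"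
  assumes "locally_compact_space (euclidean :: 'a topology)"
    and "flow \<pi>0"
    and "attractor \<pi>0 S" and "S \<noteq> {}"
    and "B \<noteq> {}" and "compact B" and "stable_isolating_block \<pi>0 B" and "A_inv \<pi>0 B = S"
    and "\<pi> = (\<lambda>(s, x) t. (s + t, \<pi>0 x t))"
    and "N = UNIV \<times> B"
  shows
    "\<exists>\<epsilon> :: real \<Rightarrow> real \<Rightarrow> real.
      (\<forall>T>0. \<forall>\<delta>>0. \<epsilon> T \<delta> > 0) \<and>
      (\<forall>(B' :: 'a set) (\<pi>n :: nat \<Rightarrow> real \<times> 'a \<Rightarrow> real \<Rightarrow> real \<times> 'a).
        B' \<noteq> {} \<and> compact B' \<and> stable_isolating_block \<pi>0 B' \<and> A_inv \<pi>0 B' = S \<and> B \<subseteq> B' \<and>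
        (\<forall>n. skew_product_flow (\<pi>n n)) \<and> semi_singular_convergence \<pi>n \<pi>0 \<longrightarrow>
        (\<exists>T0>0. \<exists>n0. \<forall>T\<ge>T0. \<forall>\<delta>>0.
          U_nbhd \<delta> (G_set \<pi> (2 * T) N) \<subseteq> G_set \<pi> T N \<and>
          U_nbhd \<delta> (G_set \<pi> T N) \<subseteq> N \<and>
          U_nbhd \<delta> B \<subseteq> B' \<and>
          G_set \<pi>0 T B' \<subseteq> B \<and>
          U_nbhd \<delta> (G_set \<pi> T (U_nbhd \<delta> N)) \<subseteq> N \<longrightarrow>
          (\<forall>n\<ge>n0.
            (\<forall>t\<in>{-T..T}. \<forall>x\<in>N. dist (\<pi>n n x t) (\<pi> x t) < \<delta> / 3) \<longrightarrow>
            A_inv (\<pi>n n) N \<noteq> {} \<and>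
            isolated_invariant_set (\<pi>n n) (A_inv (\<pi>n n) N) \<and>
            (\<forall>t. compact (A_inv (\<pi>n n) N \<inter> ({t} \<times> UNIV))) \<and>
            U_nbhd (\<epsilon> T \<delta>) (A_inv (\<pi>n n) N) \<subseteq> G_set (\<pi>n n) T N)))"
proof -
  note fl0 = \<open>flow \<pi>0\<close> and B = \<open>compact B\<close> \<open>B \<noteq> {}\<close>
  have \<pi>: "\<pi> (s, x) t = (s + t, \<pi>0 x t)" for s x t
    using \<open>\<pi> = _\<close> by simp
  have N: "N = UNIV \<times> B" by fact
  have clN: "closed N"
    unfolding N using B by (intro closed_Times) (auto intro: compact_imp_closed)
  have "\<exists>\<epsilon>>0. \<epsilon> \<le> \<delta> \<and> (\<forall>z\<in>N. \<forall>y\<in>N. \<forall>t\<in>{-T..T}. dist z y < \<epsilon> \<longrightarrow> dist (\<pi> z t) (\<pi> y t) < \<delta> / 3)"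
    if "0 < \<delta>" for T \<delta> :: real
  proof -
    have \<delta>3: "0 < \<delta> / 3" using that by simp
    obtain \<epsilon> where "0 < \<epsilon>" "\<epsilon> \<le> \<delta> / 3"
      and "\<forall>s s'. \<forall>x\<in>B. \<forall>y\<in>B. \<forall>t\<in>{-T..T}. dist (s, x) (s', y) < \<epsilon> \<longrightarrow>
           dist (s + t, \<pi>0 x t) (s' + t, \<pi>0 y t) < \<delta> / 3"
      using product_flow_equicontinuous[OF fl0 B(1) \<delta>3, of T] by (elim exE conjE)
    then show ?thesis
      using that by (intro exI[of _ \<epsilon>]) (auto simp: N \<pi>)
  qed
  then have "\<forall>T \<delta>. \<exists>\<epsilon>. 0 < \<delta> \<longrightarrow> 0 < \<epsilon> \<and> \<epsilon> \<le> \<delta> \<and>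
      (\<forall>z\<in>N. \<forall>y\<in>N. \<forall>t\<in>{-T..T}. dist z y < \<epsilon> \<longrightarrow> dist (\<pi> z t) (\<pi> y t) < \<delta> / 3)"
    by blast
  then obtain \<epsilon> :: "real \<Rightarrow> real \<Rightarrow> real" where
    \<epsilon>: "\<And>T \<delta>. 0 < \<delta> \<Longrightarrow> 0 < \<epsilon> T \<delta> \<and> \<epsilon> T \<delta> \<le> \<delta> \<and>
      (\<forall>z\<in>N. \<forall>y\<in>N. \<forall>t\<in>{-T..T}. dist z y < \<epsilon> T \<delta> \<longrightarrow> dist (\<pi> z t) (\<pi> y t) < \<delta> / 3)"
    unfolding choice_iff by blast
  define persists where "persists \<phi> T e \<longleftrightarrow>
      A_inv \<phi> N \<noteq> {} \<and> isolated_invariant_set \<phi> (A_inv \<phi> N) \<and>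
      (\<forall>t. compact (A_inv \<phi> N \<inter> ({t} \<times> UNIV))) \<and> U_nbhd e (A_inv \<phi> N) \<subseteq> G_set \<phi> T N"
    for \<phi> :: "real \<times> 'a \<Rightarrow> real \<Rightarrow> real \<times> 'a" and T e :: real
  have main: "\<exists>n0. \<forall>n\<ge>n0. \<forall>T \<delta>. 0 < \<delta> \<longrightarrow> U_nbhd \<delta> (G_set \<pi> T (U_nbhd \<delta> N)) \<subseteq> N \<longrightarrow>
      (\<forall>t\<in>{-T..T}. \<forall>x\<in>N. dist (\<pi>n n x t) (\<pi> x t) < \<delta> / 3) \<longrightarrow>
        persists (\<pi>n n) T (\<epsilon> T \<delta>)"
    if skew: "\<forall>n. skew_product_flow (\<pi>n n)" and conv: "semi_singular_convergence \<pi>n \<pi>0"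
    for \<pi>n :: "nat \<Rightarrow> real \<times> 'a \<Rightarrow> real \<Rightarrow> real \<times> 'a"
  proof -
    \<comment> \<open>Times in \<open>[1, 2]\<close> suffice: sums of such times cover \<open>[1, \<infinity>)\<close>, and they avoid \<open>t = 0\<close>, where
      boundary points of \<open>B\<close> are not in the interior.\<close>
    have "\<exists>n0. \<forall>n\<ge>n0. \<forall>s. \<forall>x\<in>B. \<forall>t\<in>{1..2}. snd (\<pi>n n (s, x) t) \<in> interior B"
      using stable_isolating_block_enters_interior[OF fl0 \<open>stable_isolating_block \<pi>0 B\<close>]
      by (intro eventually_absorbing[OF conv B(1)]) auto
    then obtain n0 where n0: "\<And>n s x t. n \<ge> n0 \<Longrightarrow> x \<in> B \<Longrightarrow> t \<in> {1..2} \<Longrightarrow>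
        snd (\<pi>n n (s, x) t) \<in> B"
      using interior_subset by blast
    have "persists (\<pi>n n) T (\<epsilon> T \<delta>)"
      if \<delta>: "0 < \<delta>" and incl: "U_nbhd \<delta> (G_set \<pi> T (U_nbhd \<delta> N)) \<subseteq> N" and n: "n \<ge> n0"
        and near: "\<forall>t\<in>{-T..T}. \<forall>x\<in>N. dist (\<pi>n n x t) (\<pi> x t) < \<delta> / 3"
      for T \<delta> n
    proof -
      let ?K = "A_inv (\<pi>n n) N"
      have fl: "flow (\<pi>n n)" using skew by (simp add: skew_product_flow_def)
      have "\<pi>n n z t \<in> N" if "z \<in> N" "t \<in> {1..2}" for z t
        using n0[OF n, of "snd z" t "fst z"] that by (auto simp: N mem_Times_iff)
      then have "\<pi>n n z t \<in> N" if "z \<in> N" "1 \<le> t" for z t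
        using absorbing_all_later_times[OF fl, of 1 N] that by simp
      then have nonempty: "?K \<noteq> {}"
        using skew_product_full_orbit_exists[of "\<pi>n n" B 1] skew B unfolding N by blast
      have ball: "y \<in> N" if "z \<in> ?K" "dist y z < \<delta>" for y z
        by (rule ball_about_full_orbit[OF fl _ incl that]) (use near \<delta> in fastforce)
      have K_int: "?K \<subseteq> interior N"
      proof
        fix z assume "z \<in> ?K"
        then have "ball z \<delta> \<subseteq> N" using ball by (metis dist_commute mem_ball subsetI)
        then show "z \<in> interior N" using \<delta> mem_interior by blast
      qed
      then have isolated: "isolated_invariant_set (\<pi>n n) ?K"
        using clN K_int by (auto simp: isolated_invariant_set_def)
      have K_N: "?K \<subseteq> N" using interior_subset by (rule subset_trans[OF K_int])
      have slices: "compact (?K \<inter> ({t} \<times> UNIV))" for t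
      proof -
        have "?K \<inter> ({t} \<times> UNIV) = ?K \<inter> ({t} \<times> B)" using K_N by (auto simp: N)
        then show ?thesis
          using closed_A_inv[OF fl clN] B by (simp add: closed_Int_compact compact_Times)
      qed
      have "U_nbhd (\<epsilon> T \<delta>) ?K \<subseteq> G_set (\<pi>n n) T N"
      proof
        fix y assume "y \<in> U_nbhd (\<epsilon> T \<delta>) ?K"
        then obtain z where z: "z \<in> ?K" and yz: "dist y z < \<epsilon> T \<delta>"
          unfolding U_nbhd_iff by blast
        have "dist y z < \<delta>" using yz \<epsilon>[OF \<delta>, of T] by linarith
        then have yN: "y \<in> N" using ball z by blast
        have "\<pi>n n y t \<in> N" if t: "t \<in> {-T..T}" for t
        proof -
          have zN: "z \<in> N" using z K_N by blast
          have "dist (\<pi>n n y t) (\<pi> y t) < \<delta> / 3" "dist (\<pi>n n z t) (\<pi> z t) < \<delta> / 3"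
            using near t yN zN by auto
          moreover have "dist (\<pi> y t) (\<pi> z t) < \<delta> / 3" using \<epsilon>[OF \<delta>, of T] yN zN t yz by blast
          moreover have "dist (\<pi>n n y t) (\<pi>n n z t)
              \<le> dist (\<pi>n n y t) (\<pi> y t) + dist (\<pi> y t) (\<pi> z t) + dist (\<pi>n n z t) (\<pi> z t)"
            by metric
          ultimately have "dist (\<pi>n n y t) (\<pi>n n z t) < \<delta>" by linarith
          then show ?thesis using ball A_inv_flow_invariant[OF fl z] by blast
        qed
        then show "y \<in> G_set (\<pi>n n) T N" using closure_subset by (fastforce simp: G_set_def)
      qed
      then show ?thesis using nonempty isolated slices by (simp add: persists_def)
    qed
    then show ?thesis by (intro exI[of _ n0] allI impI)
  qed
  show ?thesis
  proof (intro exI[of _ \<epsilon>] conjI allI impI)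
    show "0 < \<epsilon> T \<delta>" if "0 < \<delta>" for T \<delta> using \<epsilon> that by blast
  next
    fix B' :: "'a set" and \<pi>n :: "nat \<Rightarrow> real \<times> 'a \<Rightarrow> real \<Rightarrow> real \<times> 'a"
    assume "B' \<noteq> {} \<and> compact B' \<and> stable_isolating_block \<pi>0 B' \<and> A_inv \<pi>0 B' = S \<and> B \<subseteq> B' \<and>
      (\<forall>n. skew_product_flow (\<pi>n n)) \<and> semi_singular_convergence \<pi>n \<pi>0"
    then have "\<forall>n. skew_product_flow (\<pi>n n)" "semi_singular_convergence \<pi>n \<pi>0" by blast+
    from main[OF this] obtain n0 where n0: "\<forall>n\<ge>n0. \<forall>T \<delta>. 0 < \<delta> \<longrightarrow>
        U_nbhd \<delta> (G_set \<pi> T (U_nbhd \<delta> N)) \<subseteq> N \<longrightarrow>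
        (\<forall>t\<in>{-T..T}. \<forall>x\<in>N. dist (\<pi>n n x t) (\<pi> x t) < \<delta> / 3) \<longrightarrow>
        persists (\<pi>n n) T (\<epsilon> T \<delta>)" ..
    show "\<exists>T0>0. \<exists>n0. \<forall>T\<ge>T0. \<forall>\<delta>>0.
          U_nbhd \<delta> (G_set \<pi> (2 * T) N) \<subseteq> G_set \<pi> T N \<and>
          U_nbhd \<delta> (G_set \<pi> T N) \<subseteq> N \<and>
          U_nbhd \<delta> B \<subseteq> B' \<and>
          G_set \<pi>0 T B' \<subseteq> B \<and>
          U_nbhd \<delta> (G_set \<pi> T (U_nbhd \<delta> N)) \<subseteq> N \<longrightarrow>
          (\<forall>n\<ge>n0.
            (\<forall>t\<in>{-T..T}. \<forall>x\<in>N. dist (\<pi>n n x t) (\<pi> x t) < \<delta> / 3) \<longrightarrow>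
            A_inv (\<pi>n n) N \<noteq> {} \<and>
            isolated_invariant_set (\<pi>n n) (A_inv (\<pi>n n) N) \<and>
            (\<forall>t. compact (A_inv (\<pi>n n) N \<inter> ({t} \<times> UNIV))) \<and>
            U_nbhd (\<epsilon> T \<delta>) (A_inv (\<pi>n n) N) \<subseteq> G_set (\<pi>n n) T N)"
      unfolding persists_def[symmetric]
      by (rule exI[of _ 1], rule conjI[OF zero_less_one], rule exI[of _ n0],
          intro allI impI, elim conjE,
          rule n0[THEN spec, THEN mp, THEN spec, THEN spec, THEN mp, THEN mp, THEN mp]; assumption)
  qed
qed

end
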